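(* Let $u_0,v_0\in C^1(\mathbb{R}^2)$ be any real-valued functions whose first partial derivatives are uniformly bounded on $\mathbb{R}^2$. Then one can choose the constant $l>0$ so large that the solution of the Cauchy problem $$\frac{\partial u}{\partial t}+u\frac{\partial u}{\partial x}+v\frac{\partial u}{\partial y}-l v=0,\qquad \frac{\partial v}{\partial t}+u\frac{\partial v}{\partial x}+v\frac{\partial v}{\partial y}+l u=0,$$ $$u(0,x,y)=u_0(x,y),\qquad v(0,x,y)=v_0(x,y),\qquad (x,y)\in\mathbb{R}^2,$$ remains $C^1$-smooth for all $t>0$.
   Context: The system is the two-dimensional transport equation $\partial_t \mathbf{U}+(\mathbf{U},\nabla)\mathbf{U}+lL\mathbf{U}=0$ with $\mathbf{U}=(u,v)$ and $L=\begin{pmatrix}0&-1\\1&0\end{pmatrix}$, where the constant $l>0$ is the Coriolis parameter. *)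

theory Defs
  imports "HOL-Analysis.Analysis"
begin

text \<open>
  The derivative is taken within \<open>S\<close>, so that on \<open>S = {0..} \<times> UNIV\<close> the class
  is \<open>C\<^sup>1\<close> up to the initial time, with a one-sided time derivative at \<open>t = 0\<close>.
\<close>

definition C1_on :: "('a::real_normed_vector \<Rightarrow> 'b::real_normed_vector) \<Rightarrow> 'a set \<Rightarrow> bool" where
  "C1_on f S \<longleftrightarrow>
     (\<exists>f' :: 'a \<Rightarrow> 'a \<Rightarrow>\<^sub>L 'b.
        (\<forall>z\<in>S. (f has_derivative blinfun_apply (f' z)) (at z within S)) \<and> continuous_on S f')"

definition partial_x :: "(real \<times> real \<Rightarrow> real) \<Rightarrow> real \<times> real \<Rightarrow> real" where
  "partial_x f = (\<lambda>(x, y). deriv (\<lambda>s. f (s, y)) x)"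

definition partial_y :: "(real \<times> real \<Rightarrow> real) \<Rightarrow> real \<times> real \<Rightarrow> real" where
  "partial_y f = (\<lambda>(x, y). deriv (\<lambda>s. f (x, s)) y)"

text \<open>
  The time interval \<open>I\<close> is meant to be \<open>{0..}\<close> or \<open>{0..<T}\<close> with \<open>T > 0\<close>. The values of a
  solution at times outside \<open>I\<close> are irrelevant.
\<close>

definition classical_solution ::
  "real \<Rightarrow> (real \<times> real \<Rightarrow> real) \<Rightarrow> (real \<times> real \<Rightarrow> real) \<Rightarrow> real set \<Rightarrow>
   (real \<times> real \<times> real \<Rightarrow> real) \<Rightarrow> (real \<times> real \<times> real \<Rightarrow> real) \<Rightarrow> bool" where
  "classical_solution l u0 v0 I u v \<longleftrightarrow>
     C1_on u (I \<times> UNIV) \<and> C1_on v (I \<times> UNIV) \<and>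
     (\<forall>t\<in>I. \<forall>x y.
        vector_derivative (\<lambda>s. u (s, x, y)) (at t within I)
          + u (t, x, y) * partial_x (\<lambda>p. u (t, p)) (x, y)
          + v (t, x, y) * partial_y (\<lambda>p. u (t, p)) (x, y)
          - l * v (t, x, y) = 0 \<and>
        vector_derivative (\<lambda>s. v (s, x, y)) (at t within I)
          + u (t, x, y) * partial_x (\<lambda>p. v (t, p)) (x, y)
          + v (t, x, y) * partial_y (\<lambda>p. v (t, p)) (x, y)
          + l * u (t, x, y) = 0) \<and>
     (\<forall>x y. u (0, x, y) = u0 (x, y) \<and> v (0, x, y) = v0 (x, y))"

end

theory Submission
  imports Defs
begin

text \<open>
  Along a characteristic the velocity rotates with angular speed \<open>l\<close>, so the particle starting
  at \<open>z\<close> is displaced by at most a multiple of \<open>1 / l\<close> times its initial velocity, uniformly in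
  time. If \<open>l\<close> is large compared with the Lipschitz constant of the data, the flow map at every
  time is a contractive perturbation of the identity. Hence \<open>(t, z) \<mapsto> (t, z + shift (t, z))\<close> is a
  global \<open>C\<^sup>1\<close> diffeomorphism of space-time, and transporting the rotated data by it gives the
  solution. For uniqueness, any classical solution is compared with the rotated data along
  these explicit curves; the difference satisfies a homogeneous linear differential inequality
  and starts at zero. In this way no existence theorem for the characteristics of the other
  solution is needed.
\<close>

section \<open>Continuously differentiable maps and their global inverses\<close>

text \<open>In finite dimension, continuity of every directional derivative gives continuity in the
  operator norm, by checking on a basis. So derivatives can be given as plain functions and
  \<open>Blinfun\<close> stays out of later computations.\<close>

lemma C1_onI:
  fixes f :: "'a::euclidean_space \<Rightarrow> 'b::real_normed_vector"
  assumes der: "\<And>z. z \<in> S \<Longrightarrow> (f has_derivative f' z) (at z within S)"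
    and cont: "\<And>h. continuous_on S (\<lambda>z. f' z h)"
  shows "C1_on f S"
proof -
  have app: "blinfun_apply (Blinfun (f' z)) = f' z" if "z \<in> S" for z
    using der[OF that] by (intro bounded_linear_Blinfun_apply has_derivative_bounded_linear)
  have "continuous_on S (\<lambda>z. Blinfun (f' z))"
  proof (rule continuous_on_blinfun_componentwise)
    fix i :: 'a
    show "continuous_on S (\<lambda>z. blinfun_apply (Blinfun (f' z)) i)"
      using cont[of i] app by (simp cong: continuous_on_cong)
  qed
  with der app show ?thesis
    unfolding C1_on_def by (intro exI[of _ "\<lambda>z. Blinfun (f' z)"]) auto
qed

lemma C1_onE:
  assumes "C1_on f S"
  obtains f' where "\<And>z. z \<in> S \<Longrightarrow> (f has_derivative blinfun_apply (f' z)) (at z within S)"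
    and "continuous_on S f'"
  using assms unfolding C1_on_def by blast

lemma C1_on_subset: "C1_on f S \<Longrightarrow> T \<subseteq> S \<Longrightarrow> C1_on f T"
  unfolding C1_on_def by (meson continuous_on_subset has_derivative_subset subsetD)

lemma C1_on_compose:
  fixes f :: "'b::real_normed_vector \<Rightarrow> 'c::real_normed_vector"
    and g :: "'a::real_normed_vector \<Rightarrow> 'b"
  assumes "C1_on f T" "C1_on g S" "g ` S \<subseteq> T"
  shows "C1_on (\<lambda>z. f (g z)) S"
proof -
  obtain f' where f': "\<And>z. z \<in> T \<Longrightarrow> (f has_derivative blinfun_apply (f' z)) (at z within T)"
    "continuous_on T f'" using assms(1) by (rule C1_onE) blast
  obtain g' where g': "\<And>z. z \<in> S \<Longrightarrow> (g has_derivative blinfun_apply (g' z)) (at z within S)"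
    "continuous_on S g'" using assms(2) by (rule C1_onE) blast
  have "continuous_on S g"
    by (rule has_derivative_continuous_on) (rule g'(1))
  then have "continuous_on S (\<lambda>z. f' (g z) o\<^sub>L g' z)"
    by (intro bounded_bilinear.continuous_on[OF bounded_bilinear_blinfun_compose]
        continuous_on_compose2[OF f'(2) _ assms(3)] g'(2))
  moreover have "((\<lambda>z. f (g z)) has_derivative blinfun_apply (f' (g z) o\<^sub>L g' z)) (at z within S)"
    if "z \<in> S" for z
    using has_derivative_in_compose2[OF f'(1) assms(3) that g'(1)[OF that]]
    by (simp add: blinfun_compose.rep_eq o_def)
  ultimately show ?thesis unfolding C1_on_def by (intro exI[of _ "\<lambda>z. f' (g z) o\<^sub>L g' z"]) auto
qed

text \<open>Inversion of operators is continuous because \<open>B - B0 = - B (A - A0) B0\<close>;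
  the work lies in bounding \<open>B y\<close> uniformly for \<open>A y\<close> close to
  \<open>A0\<close>.\<close>

lemma tendsto_blinfun_inverse:
  fixes A :: "'c \<Rightarrow> 'a::real_normed_vector \<Rightarrow>\<^sub>L 'b::real_normed_vector"
  assumes A: "(A \<longlongrightarrow> A0) F"
    and left: "B0 o\<^sub>L A0 = id_blinfun"
    and left': "\<And>y. B y o\<^sub>L A y = id_blinfun" and right: "\<And>y. A y o\<^sub>L B y = id_blinfun"
    and right0: "A0 o\<^sub>L B0 = id_blinfun"
  shows "(B \<longlongrightarrow> B0) F"
proof -
  \<comment> \<open>Adding 1 keeps \<open>c\<close> positive even on a trivial space, where
    \<open>norm B0 = 0\<close>.\<close>
  define c where "c = norm B0 + 1"
  have c: "c > 0" "norm B0 \<le> c" by (auto simp: c_def add_nonneg_pos)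
  have idL: "blinfun_apply B0 (blinfun_apply A0 h) = h" for h
    using left by (metis blinfun_apply_blinfun_compose blinfun_apply_id_blinfun)
  have idR0: "blinfun_apply A0 (blinfun_apply B0 h) = h" for h
    using right0 by (metis blinfun_apply_blinfun_compose blinfun_apply_id_blinfun)
  have idL': "blinfun_apply (B y) (blinfun_apply (A y) h) = h" for h y
    using left' by (metis blinfun_apply_blinfun_compose blinfun_apply_id_blinfun)
  have idR: "blinfun_apply (A y) (blinfun_apply (B y) h) = h" for h y
    using right by (metis blinfun_apply_blinfun_compose blinfun_apply_id_blinfun)
  have lim0: "((\<lambda>y. norm (A y - A0)) \<longlongrightarrow> 0) F"
    using A tendsto_norm_zero LIM_zero by blast
  \<comment> \<open>Within this radius the term in \<open>k\<close> on the right of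
    \<open>k = B0 (h - (A y - A0) k)\<close> has norm at most \<open>norm k / 2\<close>, so it can
    be absorbed on the left.\<close>
  have "eventually (\<lambda>y. norm (A y - A0) < 1 / (2 * c)) F"
    using lim0 c by (intro order_tendstoD) auto
  then have "eventually (\<lambda>y. norm (B y - B0) \<le> 2 * c * c * norm (A y - A0)) F"
  proof eventually_elim
    case (elim y)
    have Bb: "norm (blinfun_apply (B y) h) \<le> 2 * c * norm h" for h
    proof -
      define k where "k = blinfun_apply (B y) h"
      have k: "k = blinfun_apply B0 (h - blinfun_apply (A y - A0) k)"
        by (simp add: k_def blinfun.diff_left idR idL)
      have "norm k \<le> norm B0 * norm (h - blinfun_apply (A y - A0) k)"
        by (subst k) (rule norm_blinfun)
      also have "\<dots> \<le> c * (norm h + norm (A y - A0) * norm k)"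
        using c by (intro mult_mono order_trans[OF norm_triangle_ineq4] add_left_mono norm_blinfun) auto
      also have "\<dots> \<le> c * (norm h + 1 / (2 * c) * norm k)"
        using c elim by (intro mult_left_mono add_left_mono mult_right_mono) auto
      also have "\<dots> = c * norm h + norm k / 2" using c by (simp add: field_simps)
      finally show ?thesis by (simp add: k_def)
    qed
    show ?case
    proof (rule norm_blinfun_bound)
      show "0 \<le> 2 * c * c * norm (A y - A0)" using c by simp
      fix h
      have "blinfun_apply (B y - B0) h
          = - blinfun_apply (B y) (blinfun_apply (A y - A0) (blinfun_apply B0 h))"
        by (simp add: blinfun.diff_left blinfun.diff_right idL' idR0)
      then have "norm (blinfun_apply (B y - B0) h)
          \<le> 2 * c * norm (blinfun_apply (A y - A0) (blinfun_apply B0 h))"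
        using Bb by simp
      also have "\<dots> \<le> 2 * c * (norm (A y - A0) * (norm B0 * norm h))"
        using c by (intro mult_left_mono order_trans[OF norm_blinfun] norm_blinfun) auto
      also have "\<dots> \<le> 2 * c * (norm (A y - A0) * (c * norm h))"
        using c by (intro mult_left_mono mult_right_mono) auto
      finally show "norm (blinfun_apply (B y - B0) h) \<le> 2 * c * c * norm (A y - A0) * norm h"
        by (simp add: mult_ac)
    qed
  qed
  then have "((\<lambda>y. B y - B0) \<longlongrightarrow> 0) F"
    by (rule Lim_null_comparison) (intro tendsto_mult_right_zero lim0)
  then show ?thesis by (rule LIM_zero_cancel)
qed

text \<open>The inverse function theorem provides only local inverses. Since \<open>g\<close>
  inverts \<open>f\<close> globally, it coincides with each of them and inherits differentiability;
  continuity of its derivative follows from continuity of inversion.\<close>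

lemma C1_on_global_inverse:
  fixes f g :: "'a::euclidean_space \<Rightarrow> 'a"
  assumes der: "\<And>z. (f has_derivative blinfun_apply (f' z)) (at z)"
    and cont: "continuous_on UNIV f'"
    and inj': "\<And>z. inj (blinfun_apply (f' z))"
    and gf: "\<And>z. g (f z) = z" and fg: "\<And>y. f (g y) = y"
  shows "C1_on g UNIV"
proof -
  have ex: "\<exists>C. C o\<^sub>L f' z = id_blinfun \<and> f' z o\<^sub>L C = id_blinfun" for z
  proof -
    have lin: "linear (blinfun_apply (f' z))"
      by (simp add: blinfun.bounded_linear_right bounded_linear.linear)
    obtain h where h: "linear h" "\<And>x. h (blinfun_apply (f' z) x) = x" "\<And>x. blinfun_apply (f' z) (h x) = x"
      using linear_injective_isomorphism[OF lin inj'] by blast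
    then have "blinfun_apply (Blinfun h) = h"
      by (simp add: bounded_linear_Blinfun_apply linear_conv_bounded_linear)
    with h show ?thesis
      by (intro exI[of _ "Blinfun h"]) (auto intro!: blinfun_eqI)
  qed
  obtain C where C: "\<And>z. C z o\<^sub>L f' z = id_blinfun" "\<And>z. f' z o\<^sub>L C z = id_blinfun"
    using ex by metis
  have CL: "blinfun_apply (C z) (blinfun_apply (f' z) h) = h" for z h
    using C(1) by (metis blinfun_apply_blinfun_compose blinfun_apply_id_blinfun)
  have CR: "blinfun_apply (f' z) (blinfun_apply (C z) h) = h" for z h
    using C(2) by (metis blinfun_apply_blinfun_compose blinfun_apply_id_blinfun)
  have inv: "inv (blinfun_apply (f' z)) = blinfun_apply (C z)" for z
    by (rule inv_equality) (auto simp: CL CR)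
  have derg: "(g has_derivative blinfun_apply (C (g y))) (at y)" for y
  proof -
    obtain U' V k k' where k: "open V" "f (g y) \<in> V" "homeomorphism U' V f k"
      "\<And>y. y \<in> V \<Longrightarrow> (k has_derivative (k' y)) (at y)"
      "\<And>y. y \<in> V \<Longrightarrow> k' y = inv (blinfun_apply (f' (k y)))"
      by (rule inverse_function_theorem[of UNIV f f' "g y" "C (g y)"]) (use der cont C(1) in auto)
    \<comment> \<open>Apply \<open>g\<close> to \<open>f (k w) = w\<close>.\<close>
    have eq: "k w = g w" if "w \<in> V" for w
      using k(3) that gf by (metis homeomorphism_apply2)
    have "y \<in> V" using k(2) fg by simp
    with k eq inv have "(k has_derivative blinfun_apply (C (g y))) (at y)" by metis
    then show ?thesis
      by (rule has_derivative_transform_within_open[OF _ k(1) \<open>y \<in> V\<close>]) (rule eq)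
  qed
  have "continuous_on UNIV (\<lambda>y. C (g y))"
  proof (simp add: continuous_on_def, intro allI)
    fix y
    have "isCont g y" using derg has_derivative_continuous by blast
    then have "((\<lambda>y. f' (g y)) \<longlongrightarrow> f' (g y)) (at y)"
      using cont by (metis UNIV_I continuous_on_eq_continuous_at isCont_def isCont_o2 open_UNIV)
    then show "((\<lambda>y. C (g y)) \<longlongrightarrow> C (g y)) (at y)"
      by (rule tendsto_blinfun_inverse) (simp_all add: C)
  qed
  with derg show ?thesis unfolding C1_on_def by (intro exI[of _ "\<lambda>y. C (g y)"]) auto
qed

text \<open>At fixed \<open>t\<close>, the mean value inequality makes \<open>P\<close> a
  contraction in space, so \<open>x + P (t, x) = z\<close> is a Banach fixed point problem for
  \<open>x\<close>. Carrying time along as a first component makes the inverse smooth jointly in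
  time and space.\<close>

lemma perturbed_identity_inverse:
  fixes P :: "real \<times> 'a::euclidean_space \<Rightarrow> 'a"
  assumes der: "\<And>z. (P has_derivative P' z) (at z)"
    and cont: "\<And>h. continuous_on UNIV (\<lambda>z. P' z h)"
    and bound: "\<And>z h. norm (P' z (0, h)) \<le> q * norm h" and "q < 1"
  obtains Z where "C1_on (\<lambda>p. (fst p, Z p)) UNIV" "\<And>t z. Z (t, z + P (t, z)) = z"
    "\<And>t z. Z (t, z) + P (t, Z (t, z)) = z"
proof -
  \<comment> \<open>Banach's theorem and the operator norm bound ask for a nonnegative
    constant.\<close>
  define r where "r = max q 0"
  have r: "0 \<le> r" "r < 1" using \<open>q < 1\<close> by (auto simp: r_def)
  have bound': "norm (P' z (0, h)) \<le> r * norm h" for z h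
    using bound[of z h] mult_right_mono[of q r "norm h"] by (simp add: r_def)
  have lip: "norm (P (t, x) - P (t, y)) \<le> r * norm (x - y)" for t x y
  proof (rule differentiable_bound[of UNIV])
    show "((\<lambda>x. P (t, x)) has_derivative (\<lambda>h. P' (t, x) (0, h))) (at x)" for x
      by (rule has_derivative_compose[OF _ der]) (auto intro!: derivative_eq_intros)
    show "onorm (\<lambda>h. P' (t, x) (0, h)) \<le> r" for x
      by (rule onorm_bound[OF r(1) bound'])
  qed auto
  have uniq: "\<exists>!x. x + P (t, x) = z" for t z
  proof -
    have "\<exists>!x. z - P (t, x) = x"
      using r lip by (intro banach_fix_type[of r]) (auto simp: dist_norm norm_minus_commute)
    moreover have "z - P (t, x) = x \<longleftrightarrow> x + P (t, x) = z" for x by (auto simp: algebra_simps)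
    ultimately show ?thesis by simp
  qed
  define Z where "Z = (\<lambda>(t, z). THE x. x + P (t, x) = z)"
  have Z1: "Z (t, z) + P (t, Z (t, z)) = z" for t z
    using theI'[OF uniq] by (simp add: Z_def)
  have Z2: "Z (t, z + P (t, z)) = z" for t z
    using uniq Z1 by blast
  define F where "F = (\<lambda>p. (fst p, snd p + P p))"
  define F' where "F' = (\<lambda>p h. (fst h, snd h + P' p h))"
  define G where "G = (\<lambda>p. (fst p, Z p))"
  have derF: "(F has_derivative F' p) (at p)" for p
    unfolding F_def F'_def by (auto intro!: derivative_eq_intros der)
  have app: "blinfun_apply (Blinfun (F' p)) = F' p" for p
    using derF by (intro bounded_linear_Blinfun_apply has_derivative_bounded_linear)
  have "C1_on G UNIV"
  proof (rule C1_on_global_inverse[of F "\<lambda>p. Blinfun (F' p)"])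
    show "continuous_on UNIV (\<lambda>p. Blinfun (F' p))"
      by (rule continuous_on_blinfun_componentwise, unfold app, unfold F'_def)
        (intro continuous_intros cont)
    show "inj (blinfun_apply (Blinfun (F' p)))" for p
    proof (subst linear_injective_0)
      show "linear (blinfun_apply (Blinfun (F' p)))"
        by (simp add: blinfun.bounded_linear_right bounded_linear.linear)
      \<comment> \<open>The derivative of \<open>F\<close> preserves the time component, so a kernel
        vector is purely spatial; its spatial part \<open>k = - P' p (0, k)\<close> vanishes by
        contractivity.\<close>
      have "h = 0" if h0: "F' p h = 0" for h
      proof -
        obtain k where k: "h = (0, k)" "k + P' p (0, k) = 0"
          using h0 by (cases h) (auto simp: F'_def zero_prod_def)
        from k(2) have "norm k = norm (P' p (0, k))" by (metis add_eq_0_iff norm_minus_cancel)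
        then have "norm k \<le> r * norm k" using bound'[of p k] by simp
        then have "(1 - r) * norm k \<le> 0" by (simp add: algebra_simps)
        then have "norm k = 0" using r by (simp add: mult_le_0_iff)
        with k show ?thesis by (simp add: zero_prod_def)
      qed
      then show "\<forall>h. blinfun_apply (Blinfun (F' p)) h = 0 \<longrightarrow> h = 0" by (simp add: app)
    qed
  qed (use derF app Z1 Z2 in \<open>auto simp: F_def G_def\<close>)
  with Z1 Z2 that show thesis unfolding G_def by blast
qed

section \<open>Inertial oscillations\<close>

text \<open>
  \<open>vel\<close> solves \<open>x'' = l y'\<close>, \<open>y'' = - l x'\<close> with initial velocity \<open>(a, b)\<close>; \<open>shift\<close> is the
  resulting displacement.
\<close>

definition vel_x :: "real \<Rightarrow> real \<Rightarrow> real \<Rightarrow> real \<Rightarrow> real" where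
  "vel_x l a b t = cos (l * t) * a + sin (l * t) * b"

definition vel_y :: "real \<Rightarrow> real \<Rightarrow> real \<Rightarrow> real \<Rightarrow> real" where
  "vel_y l a b t = cos (l * t) * b - sin (l * t) * a"

definition shift_x :: "real \<Rightarrow> real \<Rightarrow> real \<Rightarrow> real \<Rightarrow> real" where
  "shift_x l a b t = (sin (l * t) * a + (1 - cos (l * t)) * b) / l"

definition shift_y :: "real \<Rightarrow> real \<Rightarrow> real \<Rightarrow> real \<Rightarrow> real" where
  "shift_y l a b t = (sin (l * t) * b - (1 - cos (l * t)) * a) / l"

lemma vel_0 [simp]: "vel_x l a b 0 = a" "vel_y l a b 0 = b"
  and shift_0 [simp]: "shift_x l a b 0 = 0" "shift_y l a b 0 = 0"
  by (auto simp: vel_x_def vel_y_def shift_x_def shift_y_def)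

lemma vel_x_deriv: "(vel_x l a b has_real_derivative l * vel_y l a b t) (at t within S)"
  unfolding vel_x_def vel_y_def
  by (auto intro!: derivative_eq_intros simp: algebra_simps)

lemma vel_y_deriv: "(vel_y l a b has_real_derivative - l * vel_x l a b t) (at t within S)"
  unfolding vel_x_def vel_y_def
  by (auto intro!: derivative_eq_intros simp: algebra_simps)

lemma shift_x_deriv:
  "l \<noteq> 0 \<Longrightarrow> (shift_x l a b has_real_derivative vel_x l a b t) (at t within S)"
  unfolding vel_x_def shift_x_def
  by (auto intro!: derivative_eq_intros simp: field_simps)

lemma shift_y_deriv:
  "l \<noteq> 0 \<Longrightarrow> (shift_y l a b has_real_derivative vel_y l a b t) (at t within S)"
  unfolding vel_y_def shift_y_def
  by (auto intro!: derivative_eq_intros simp: field_simps)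

text \<open>The 3 is 1 for the sine plus 2 for \<open>1 - cos\<close>. The bound is uniform in
  \<open>t\<close> and gains a factor \<open>1 / l\<close>. As the shift is linear in
  \<open>(a, b)\<close>, it applies equally to derivatives of the data.\<close>

lemma shift_bound:
  assumes "l > 0" "\<bar>a\<bar> \<le> c" "\<bar>b\<bar> \<le> c"
  shows "\<bar>shift_x l a b t\<bar> \<le> 3 * c / l" and "\<bar>shift_y l a b t\<bar> \<le> 3 * c / l"
proof -
  have *: "\<bar>sin (l * t) * p\<bar> \<le> c" "\<bar>(1 - cos (l * t)) * p\<bar> \<le> 2 * c" if "\<bar>p\<bar> \<le> c" for p
  proof -
    have "\<bar>sin (l * t)\<bar> * \<bar>p\<bar> \<le> 1 * c"
      using that abs_sin_le_one by (intro mult_mono) auto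
    moreover have "\<bar>1 - cos (l * t)\<bar> * \<bar>p\<bar> \<le> 2 * c"
      using that abs_cos_le_one[of "l * t"] by (intro mult_mono) auto
    ultimately show "\<bar>sin (l * t) * p\<bar> \<le> c" "\<bar>(1 - cos (l * t)) * p\<bar> \<le> 2 * c"
      by (auto simp: abs_mult)
  qed
  show "\<bar>shift_x l a b t\<bar> \<le> 3 * c / l" "\<bar>shift_y l a b t\<bar> \<le> 3 * c / l"
    using *(1)[OF assms(2)] *(1)[OF assms(3)] *(2)[OF assms(2)] *(2)[OF assms(3)] \<open>l > 0\<close>
    unfolding shift_x_def shift_y_def abs_divide by (auto intro!: divide_right_mono)
qed

section \<open>Derivatives along curves\<close>

text \<open>This turns the coordinate form of the equations into one directional derivative of
  \<open>f\<close> in space-time. The condition on \<open>at t within I\<close> makes the possibly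
  one-sided time derivative unique.\<close>

lemma material_derivative:
  fixes f :: "real \<times> real \<times> real \<Rightarrow> real"
  assumes der: "(f has_derivative f') (at (t, x, y) within I \<times> UNIV)"
    and "t \<in> I" and nb: "at t within I \<noteq> bot"
  shows "vector_derivative (\<lambda>s. f (s, x, y)) (at t within I)
           + a * partial_x (\<lambda>p. f (t, p)) (x, y) + b * partial_y (\<lambda>p. f (t, p)) (x, y) = f' (1, a, b)"
proof -
  interpret f': bounded_linear f' using der by (rule has_derivative_bounded_linear)
  have split: "f' (s, a, b) = s * f' (1, 0, 0) + a * f' (0, 1, 0) + b * f' (0, 0, 1)" for s a b
  proof -
    have "(s, a, b) = s *\<^sub>R (1, 0, 0) + a *\<^sub>R (0, 1, 0) + b *\<^sub>R (0, 0, 1)" by simp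
    then show ?thesis by (metis f'.add f'.scaleR real_scaleR_def)
  qed
  \<comment> \<open>The domain \<open>J\<close> of the curve is \<open>I\<close> for the time line
    and the whole real line for the two spatial lines, which never leave
    \<open>I \<times> UNIV\<close>.\<close>
  have chain: "((\<lambda>s. f (g s)) has_derivative (\<lambda>s. f' (g' s))) (at r within J)"
    if "(g has_derivative g') (at r within J)" "g r = (t, x, y)" "g ` J \<subseteq> I \<times> UNIV" for g g' r J
    using that der has_derivative_subset by (intro has_derivative_in_compose[of g g' r J f f']) auto
  have "((\<lambda>s. f (s, x, y)) has_vector_derivative f' (1, 0, 0)) (at t within I)"
  proof -
    have "((\<lambda>s. f (s, x, y)) has_derivative (\<lambda>s. f' (s, 0, 0))) (at t within I)"
      by (rule chain) (auto intro!: derivative_eq_intros simp: zero_prod_def)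
    moreover have "(\<lambda>s. f' (s, 0, 0)) = (\<lambda>s. s *\<^sub>R f' (1, 0, 0))"
      by (rule ext, subst split) simp
    ultimately show ?thesis by (simp add: has_vector_derivative_def)
  qed
  then have 1: "vector_derivative (\<lambda>s. f (s, x, y)) (at t within I) = f' (1, 0, 0)"
    by (rule vector_derivative_within[OF nb])
  have "((\<lambda>s. f (t, s, y)) has_derivative (\<lambda>s. f' (0, s, 0))) (at x)"
    by (rule chain) (use \<open>t \<in> I\<close> in \<open>auto intro!: derivative_eq_intros\<close>)
  moreover have "(\<lambda>s. f' (0, s, 0)) = (*) (f' (0, 1, 0))"
    by (rule ext, subst split) simp
  ultimately have 2: "partial_x (\<lambda>p. f (t, p)) (x, y) = f' (0, 1, 0)"
    unfolding partial_x_def by (auto simp: has_field_derivative_def intro!: DERIV_imp_deriv)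
  have "((\<lambda>s. f (t, x, s)) has_derivative (\<lambda>s. f' (0, 0, s))) (at y)"
    by (rule chain) (use \<open>t \<in> I\<close> in \<open>auto intro!: derivative_eq_intros\<close>)
  moreover have "(\<lambda>s. f' (0, 0, s)) = (*) (f' (0, 0, 1))"
    by (rule ext, subst split) simp
  ultimately have 3: "partial_y (\<lambda>p. f (t, p)) (x, y) = f' (0, 0, 1)"
    unfolding partial_y_def by (auto simp: has_field_derivative_def intro!: DERIV_imp_deriv)
  show ?thesis unfolding 1 2 3 by (subst split[of 1 a b]) simp
qed

text \<open>The factor 2 comes from summing two partial derivatives, each multiplied by a component
  of \<open>h\<close> that is at most \<open>norm h\<close>.\<close>

lemma derivative_bound_of_partials:
  fixes f :: "real \<times> real \<Rightarrow> real"
  assumes der: "(f has_derivative f') (at z)"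
    and "\<bar>partial_x f z\<bar> \<le> B" "\<bar>partial_y f z\<bar> \<le> B"
  shows "\<bar>f' h\<bar> \<le> 2 * B * norm h"
proof -
  interpret f': bounded_linear f' using der by (rule has_derivative_bounded_linear)
  obtain x y where z: "z = (x, y)" by (cases z)
  obtain a b where h: "h = (a, b)" by (cases h)
  have split: "f' (a, b) = f' (1, 0) * a + f' (0, 1) * b" for a b
  proof -
    have "(a, b) = a *\<^sub>R (1, 0) + b *\<^sub>R (0, 1)" by simp
    then show ?thesis by (metis f'.add f'.scaleR real_scaleR_def mult.commute)
  qed
  have "((\<lambda>s. f (s, y)) has_derivative (\<lambda>s. f' (s, 0))) (at x)"
    by (rule has_derivative_compose[of "\<lambda>s. (s, y)"]) (use der z in \<open>auto intro!: derivative_eq_intros\<close>)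
  moreover have "(\<lambda>s. f' (s, 0)) = (*) (f' (1, 0))"
    by (rule ext, subst split) simp
  ultimately have 1: "partial_x f z = f' (1, 0)"
    unfolding partial_x_def z by (auto simp: has_field_derivative_def intro!: DERIV_imp_deriv)
  have "((\<lambda>s. f (x, s)) has_derivative (\<lambda>s. f' (0, s))) (at y)"
    by (rule has_derivative_compose[of "\<lambda>s. (x, s)"]) (use der z in \<open>auto intro!: derivative_eq_intros\<close>)
  moreover have "(\<lambda>s. f' (0, s)) = (*) (f' (0, 1))"
    by (rule ext, subst split) simp
  ultimately have 2: "partial_y f z = f' (0, 1)"
    unfolding partial_y_def z by (auto simp: has_field_derivative_def intro!: DERIV_imp_deriv)
  have "\<bar>f' h\<bar> \<le> \<bar>partial_x f z\<bar> * \<bar>a\<bar> + \<bar>partial_y f z\<bar> * \<bar>b\<bar>"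
    unfolding 1 2 h split[of a b] by (metis abs_mult abs_triangle_ineq)
  also have "\<dots> \<le> B * norm h + B * norm h"
    using assms(2,3) norm_fst_le[of a b] norm_snd_le[of b a] unfolding h
    by (intro add_mono mult_mono) auto
  finally show ?thesis by simp
qed

text \<open>The weighted energy \<open>exp (- 2 K s) (D s \<bullet> D s)\<close> is nonincreasing,
  nonnegative and initially zero. An inner product makes the squared norm differentiable even at
  zeros of \<open>D\<close>.\<close>

lemma gronwall_zero:
  fixes D :: "real \<Rightarrow> 'a::real_inner"
  assumes der: "\<And>s. s \<in> {0..t} \<Longrightarrow> (D has_vector_derivative D' s) (at s within {0..t})"
    and bound: "\<And>s. s \<in> {0..t} \<Longrightarrow> norm (D' s) \<le> K * norm (D s)"
    and "D 0 = 0" "0 \<le> t"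
  shows "D t = 0"
proof -
  define E where "E s = exp (- (2 * K * s)) * (D s \<bullet> D s)" for s
  define E' where "E' s = exp (- (2 * K * s)) * (2 * (D s \<bullet> D' s) - 2 * K * (D s \<bullet> D s))" for s
  have E: "(E has_real_derivative E' s) (at s within {0..t})" if "s \<in> {0..t}" for s
    using der[OF that]
    unfolding E_def E'_def has_vector_derivative_def has_field_derivative_def
    by (auto intro!: derivative_eq_intros simp: algebra_simps inner_commute)
  have nonpos: "E' s \<le> 0" if "s \<in> {0..t}" for s
  proof -
    have "D s \<bullet> D' s \<le> norm (D s) * norm (D' s)" by (rule norm_cauchy_schwarz)
    also have "\<dots> \<le> norm (D s) * (K * norm (D s))"
      using bound[OF that] by (intro mult_left_mono) auto
    also have "\<dots> = K * (D s \<bullet> D s)" by (simp add: dot_square_norm power2_eq_square)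
    finally show ?thesis unfolding E'_def by (intro mult_nonneg_nonpos) auto
  qed
  have "E t \<le> E 0"
  proof (rule DERIV_nonpos_imp_decreasing_open[OF \<open>0 \<le> t\<close>])
    show "continuous_on {0..t} E"
      using E by (meson DERIV_continuous_on)
    fix s assume "0 < s" "s < t"
    then show "\<exists>y. (E has_real_derivative y) (at s) \<and> y \<le> 0"
      using E[of s] nonpos[of s] at_within_Icc_at[of 0 s t] by auto
  qed
  then have "D t \<bullet> D t \<le> 0" using \<open>D 0 = 0\<close> by (simp add: E_def mult_le_0_iff)
  then show ?thesis by (metis inner_eq_zero_iff inner_ge_zero order_antisym)
qed

section \<open>The flow of the rotating system\<close>

text \<open>Each of the two components of the displacement has spatial derivative at most
  \<open>3 * M / l\<close>; the condition \<open>6 * M < l\<close> makes their sum less than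
  1.\<close>

locale inertial_flow =
  fixes l M :: real and u0 v0 :: "real \<times> real \<Rightarrow> real"
    and u0' v0' :: "real \<times> real \<Rightarrow> (real \<times> real) \<Rightarrow>\<^sub>L real"
  assumes l: "0 < l" "6 * M < l"
    and u0: "\<And>z. (u0 has_derivative blinfun_apply (u0' z)) (at z)" "continuous_on UNIV u0'"
      "\<And>z h. \<bar>blinfun_apply (u0' z) h\<bar> \<le> M * norm h"
    and v0: "\<And>z. (v0 has_derivative blinfun_apply (v0' z)) (at z)" "continuous_on UNIV v0'"
      "\<And>z h. \<bar>blinfun_apply (v0' z) h\<bar> \<le> M * norm h"
begin

text \<open>Here and in \<open>V\<close> and \<open>shift\<close> the argument is Lagrangian: a time
  together with the initial position of a particle, not its current one.\<close>

definition U :: "real \<times> real \<times> real \<Rightarrow> real" where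
  "U p = vel_x l (u0 (snd p)) (v0 (snd p)) (fst p)"

definition V :: "real \<times> real \<times> real \<Rightarrow> real" where
  "V p = vel_y l (u0 (snd p)) (v0 (snd p)) (fst p)"

definition shift :: "real \<times> real \<times> real \<Rightarrow> real \<times> real" where
  "shift p = (shift_x l (u0 (snd p)) (v0 (snd p)) (fst p), shift_y l (u0 (snd p)) (v0 (snd p)) (fst p))"

lemma data_derivative:
  "((\<lambda>p. u0 (snd p)) has_derivative (\<lambda>h. blinfun_apply (u0' (snd p)) (snd h))) (at p)"
  "((\<lambda>p. v0 (snd p)) has_derivative (\<lambda>h. blinfun_apply (v0' (snd p)) (snd h))) (at p)"
  for p :: "real \<times> real \<times> real"
  by (rule has_derivative_compose[OF _ u0(1)] has_derivative_compose[OF _ v0(1)];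
      auto intro!: derivative_eq_intros)+

lemma data_continuous:
  "continuous_on S (\<lambda>p. u0 (snd p))" "continuous_on S (\<lambda>p. v0 (snd p))"
  "continuous_on S (\<lambda>p. blinfun_apply (u0' (snd p)) h)"
  "continuous_on S (\<lambda>p. blinfun_apply (v0' (snd p)) h)"
  for S :: "(real \<times> real \<times> real) set"
proof -
  have "continuous_on UNIV u0" "continuous_on UNIV v0"
    by (rule has_derivative_continuous_on, rule u0 v0)+
  then show "continuous_on S (\<lambda>p. u0 (snd p))" "continuous_on S (\<lambda>p. v0 (snd p))"
    by (auto intro!: continuous_on_compose2[of UNIV _ S snd] continuous_intros)
  show "continuous_on S (\<lambda>p. blinfun_apply (u0' (snd p)) h)"
    "continuous_on S (\<lambda>p. blinfun_apply (v0' (snd p)) h)"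
    by (auto intro!: continuous_intros continuous_on_compose2[OF u0(2), of S snd]
        continuous_on_compose2[OF v0(2), of S snd])
qed

lemma C1_on_U: "C1_on U UNIV"
proof (rule C1_onI)
  show "(U has_derivative (\<lambda>h. vel_x l (blinfun_apply (u0' (snd p)) (snd h))
      (blinfun_apply (v0' (snd p)) (snd h)) (fst p) + fst h * (l * V p))) (at p)" for p
    unfolding U_def[abs_def] V_def vel_x_def vel_y_def
    by (auto intro!: derivative_eq_intros data_derivative simp: algebra_simps)
  show "continuous_on UNIV (\<lambda>p. vel_x l (blinfun_apply (u0' (snd p)) (snd h))
      (blinfun_apply (v0' (snd p)) (snd h)) (fst p) + fst h * (l * V p))" for h
    unfolding V_def[abs_def] vel_x_def vel_y_def by (intro continuous_intros data_continuous)
qed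

lemma C1_on_V: "C1_on V UNIV"
proof (rule C1_onI)
  show "(V has_derivative (\<lambda>h. vel_y l (blinfun_apply (u0' (snd p)) (snd h))
      (blinfun_apply (v0' (snd p)) (snd h)) (fst p) - fst h * (l * U p))) (at p)" for p
    unfolding U_def V_def[abs_def] vel_x_def vel_y_def
    by (auto intro!: derivative_eq_intros data_derivative simp: algebra_simps)
  show "continuous_on UNIV (\<lambda>p. vel_y l (blinfun_apply (u0' (snd p)) (snd h))
      (blinfun_apply (v0' (snd p)) (snd h)) (fst p) - fst h * (l * U p))" for h
    unfolding U_def[abs_def] vel_x_def vel_y_def by (intro continuous_intros data_continuous)
qed

section \<open>Invertibility of the flow map\<close>

lemma shift_inverse:
  obtains Z where "C1_on (\<lambda>p. (fst p, Z p)) UNIV" "\<And>t z. Z (t, z + shift (t, z)) = z"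
    "\<And>t z. Z (t, z) + shift (t, Z (t, z)) = z"
proof -
  \<comment> \<open>By linearity of the shift in the velocity, its spatial derivative is the shift
    of the differentiated data; its time derivative is the velocity \<open>(U, V)\<close>.\<close>
  define S' where "S' = (\<lambda>p h.
    (shift_x l (blinfun_apply (u0' (snd p)) (snd h)) (blinfun_apply (v0' (snd p)) (snd h)) (fst p)
       + fst h * U p,
     shift_y l (blinfun_apply (u0' (snd p)) (snd h)) (blinfun_apply (v0' (snd p)) (snd h)) (fst p)
       + fst h * V p))"
  show thesis
  proof (rule perturbed_identity_inverse[of shift S' "6 * M / l"])
    show "(shift has_derivative S' p) (at p)" for p
      unfolding shift_def[abs_def] S'_def shift_x_def shift_y_def U_def V_def vel_x_def vel_y_def
      by (rule has_derivative_Pair; insert l;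
          auto intro!: derivative_eq_intros data_derivative simp: field_simps)
    show "continuous_on UNIV (\<lambda>p. S' p h)" for h
    proof -
      have *: "continuous_on UNIV (\<lambda>p. f p / l)" if "continuous_on UNIV f"
        for f :: "real \<times> real \<times> real \<Rightarrow> real"
        using l(1) by (intro continuous_on_divide[OF that continuous_on_const]) simp
      show ?thesis
        unfolding S'_def shift_x_def shift_y_def U_def V_def vel_x_def vel_y_def
        by (intro continuous_on_Pair continuous_on_add * continuous_on_diff continuous_on_mult
            continuous_on_sin continuous_on_cos continuous_on_fst continuous_on_id
            continuous_on_const data_continuous)
    qed
    show "norm (S' p (0, h)) \<le> 6 * M / l * norm h" for p h
    proof -
      have "norm (S' p (0, h)) \<le> norm (fst (S' p (0, h))) + norm (snd (S' p (0, h)))"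
        using norm_Pair_le[of "fst (S' p (0, h))" "snd (S' p (0, h))"] by simp
      also have "\<dots> \<le> 3 * (M * norm h) / l + 3 * (M * norm h) / l"
        using shift_bound[OF l(1) u0(3)[of "snd p" h] v0(3)[of "snd p" h], of "fst p"]
        by (intro add_mono) (simp_all add: S'_def)
      finally show ?thesis by simp
    qed
    show "6 * M / l < 1" using l by simp
  qed (rule that)
qed

section \<open>Transport along the explicit characteristics\<close>

lemma characteristic_deriv:
  "((\<lambda>s. (s, z + shift (s, z))) has_vector_derivative (1, U (t, z), V (t, z))) (at t within S)"
proof -
  have "(shift_x l (u0 z) (v0 z) has_vector_derivative U (t, z)) (at t within S)"
    "(shift_y l (u0 z) (v0 z) has_vector_derivative V (t, z)) (at t within S)"
    using shift_x_deriv shift_y_deriv l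
    by (auto simp: U_def V_def has_real_derivative_iff_has_vector_derivative[symmetric])
  then have "((\<lambda>s. (s, z + (shift_x l (u0 z) (v0 z) s, shift_y l (u0 z) (v0 z) s)))
      has_vector_derivative (1, 0 + (U (t, z), V (t, z)))) (at t within S)"
    by (intro has_vector_derivative_Pair has_vector_derivative_add has_vector_derivative_const
        has_vector_derivative_id)
  then show ?thesis by (simp add: shift_def)
qed

text \<open>Chain rule for an arbitrary differentiable \<open>f\<close>, whether or not it solves
  the system. The general \<open>I\<close> covers both the constructed solution, with
  \<open>UNIV\<close>, and a competing one, with \<open>{0..<T}\<close>.\<close>

lemma along_characteristic:
  assumes "\<And>p. p \<in> I \<times> UNIV \<Longrightarrow> (f has_derivative f' p) (at p within I \<times> UNIV)" "t \<in> I"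
  shows "((\<lambda>s. f (s, z + shift (s, z))) has_vector_derivative
    f' (t, z + shift (t, z)) (1, U (t, z), V (t, z))) (at t within I)"
proof -
  interpret f': bounded_linear "f' (t, z + shift (t, z))"
    by (rule has_derivative_bounded_linear[OF assms(1)]) (simp add: assms(2))
  have "((\<lambda>s. f (s, z + shift (s, z))) has_derivative
      (\<lambda>r. f' (t, z + shift (t, z)) (r *\<^sub>R (1, U (t, z), V (t, z))))) (at t within I)"
    by (rule has_derivative_in_compose2[OF assms(1) _ assms(2)
          characteristic_deriv[unfolded has_vector_derivative_def]]) auto
  then show ?thesis by (simp only: has_vector_derivative_def f'.scaleR)
qed

lemma U_deriv: "((\<lambda>s. U (s, z)) has_vector_derivative l * V (t, z)) (at t within S)"
  using vel_x_deriv
  by (simp add: U_def V_def has_real_derivative_iff_has_vector_derivative[symmetric])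

lemma V_deriv: "((\<lambda>s. V (s, z)) has_vector_derivative - l * U (t, z)) (at t within S)"
  using vel_y_deriv
  by (simp add: U_def V_def has_real_derivative_iff_has_vector_derivative[symmetric])

text \<open>Along a characteristic \<open>u\<close> equals \<open>U\<close>, whose time derivative
  is \<open>l * V\<close>; the chain rule expresses the same derivative as
  \<open>u' (1, u, v)\<close>. Equating the two gives the first equation at each point of the curve,
  likewise the second for \<open>v\<close>, and the curves cover space-time.\<close>

lemma classical_solutionI:
  assumes C1: "C1_on u UNIV" "C1_on v UNIV"
    and u: "\<And>t z. u (t, z + shift (t, z)) = U (t, z)"
    and v: "\<And>t z. v (t, z + shift (t, z)) = V (t, z)"
    and surj: "\<And>t w. \<exists>z. w = z + shift (t, z)"
  shows "classical_solution l u0 v0 {0..} u v"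
proof -
  obtain u' where u': "\<And>p. (u has_derivative blinfun_apply (u' p)) (at p)"
    by (rule C1_onE[OF C1(1)]) blast
  obtain v' where v': "\<And>p. (v has_derivative blinfun_apply (v' p)) (at p)"
    by (rule C1_onE[OF C1(2)]) blast
  have pde: "blinfun_apply (u' (t, x, y)) (1, u (t, x, y), v (t, x, y)) = l * v (t, x, y) \<and>
      blinfun_apply (v' (t, x, y)) (1, u (t, x, y), v (t, x, y)) = - l * u (t, x, y)" for t x y
  proof -
    obtain z where z: "(x, y) = z + shift (t, z)" using surj by blast
    have "((\<lambda>s. U (s, z)) has_vector_derivative
        blinfun_apply (u' (t, x, y)) (1, U (t, z), V (t, z))) (at t)"
      using along_characteristic[of UNIV u "\<lambda>p. blinfun_apply (u' p)" t z] u' by (simp add: u z)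
    moreover have "((\<lambda>s. U (s, z)) has_vector_derivative l * V (t, z)) (at t)"
      by (rule U_deriv)
    moreover have "((\<lambda>s. V (s, z)) has_vector_derivative
        blinfun_apply (v' (t, x, y)) (1, U (t, z), V (t, z))) (at t)"
      using along_characteristic[of UNIV v "\<lambda>p. blinfun_apply (v' p)" t z] v' by (simp add: v z)
    moreover have "((\<lambda>s. V (s, z)) has_vector_derivative - l * U (t, z)) (at t)"
      by (rule V_deriv)
    ultimately show ?thesis
      unfolding z u v by (metis vector_derivative_unique_at)
  qed
  \<comment> \<open>A connected set with at least two points has no isolated point; this includes
    the endpoint 0.\<close>
  have nb: "at t within {0..} \<noteq> bot" if "t \<in> {0..}" for t :: real
  proof -
    have "t + 1 \<in> {0..}" "t + 1 \<noteq> t" using that by auto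
    then have "\<nexists>a. {0::real..} = {a}" using that by (metis singletonD)
    then show ?thesis
      using that by (simp add: trivial_limit_within connected_imp_perfect)
  qed
  have "u (0, x, y) = u0 (x, y)" "v (0, x, y) = v0 (x, y)" for x y
    using u[of 0 "(x, y)"] v[of 0 "(x, y)"] by (auto simp: shift_def U_def V_def)
  moreover have "C1_on u ({0..} \<times> UNIV)" "C1_on v ({0..} \<times> UNIV)"
    using C1 C1_on_subset by blast+
  ultimately show ?thesis
    using pde nb material_derivative[OF has_derivative_at_withinI[OF u']]
      material_derivative[OF has_derivative_at_withinI[OF v']]
    by (simp add: classical_solution_def)
qed

text \<open>This is the core of uniqueness: the values of any solution on each explicit curve are
  forced by the data. The mismatch \<open>(a, b)\<close> between \<open>(u, v)\<close> and
  \<open>(U, V)\<close> is shown to vanish by \<open>gronwall_zero\<close>.\<close>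

lemma classical_solution_along_characteristic:
  assumes sol: "classical_solution l u0 v0 {0..<T} u v" and t: "t \<in> {0..<T}"
  shows "u (t, z + shift (t, z)) = U (t, z) \<and> v (t, z + shift (t, z)) = V (t, z)"
proof -
  let ?I = "{0..<T}"
  have C1: "C1_on u (?I \<times> UNIV)" "C1_on v (?I \<times> UNIV)"
    using sol unfolding classical_solution_def by blast+
  define \<gamma> where "\<gamma> s = (s, z + shift (s, z))" for s
  obtain u' where u': "\<And>p. p \<in> ?I \<times> UNIV \<Longrightarrow> (u has_derivative blinfun_apply (u' p)) (at p within ?I \<times> UNIV)"
    "continuous_on (?I \<times> UNIV) u'"
    by (rule C1_onE[OF C1(1)]) blast
  obtain v' where v': "\<And>p. p \<in> ?I \<times> UNIV \<Longrightarrow> (v has_derivative blinfun_apply (v' p)) (at p within ?I \<times> UNIV)"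
    "continuous_on (?I \<times> UNIV) v'"
    by (rule C1_onE[OF C1(2)]) blast
  have nb: "at s within ?I \<noteq> bot" if "s \<in> ?I" for s
  proof -
    have "(s + T) / 2 \<in> ?I" "(s + T) / 2 \<noteq> s" using that by auto
    then have "\<nexists>a. ?I = {a}" using that by (metis singletonD)
    then show ?thesis
      using that by (simp add: trivial_limit_within connected_imp_perfect)
  qed
  \<comment> \<open>The equations are rewritten as derivatives in the direction
    \<open>(1, u, v)\<close>, to be compared with the direction \<open>(1, U, V)\<close> of the
    curve.\<close>
  have pde: "blinfun_apply (u' p) (1, u p, v p) = l * v p \<and>
      blinfun_apply (v' p) (1, u p, v p) = - l * u p" if pI: "p \<in> ?I \<times> UNIV" for p
  proof -
    obtain s x y where p: "p = (s, x, y)" "s \<in> ?I" using pI by (cases p) auto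
    show ?thesis
      using sol[unfolded classical_solution_def, THEN conjunct2, THEN conjunct2, THEN conjunct1,
          rule_format, OF p(2), of x y,
          unfolded material_derivative[OF u'(1)[OF pI, unfolded p(1)] p(2) nb[OF p(2)]]
            material_derivative[OF v'(1)[OF pI, unfolded p(1)] p(2) nb[OF p(2)]]]
      by (simp add: p(1))
  qed
  have \<gamma>I: "\<gamma> s \<in> ?I \<times> UNIV" if "s \<in> {0..t}" for s using that t by (auto simp: \<gamma>_def)
  have \<gamma>c: "continuous_on {0..t} \<gamma>"
    unfolding \<gamma>_def using characteristic_deriv
    by (meson continuous_on_eq_continuous_within has_vector_derivative_continuous)
  \<comment> \<open>The derivatives of an arbitrary solution carry no global bound and may grow as
    time approaches \<open>T\<close>. Compactness of one curve up to the fixed time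
    \<open>t < T\<close> supplies the constants for the Gronwall argument.\<close>
  have "compact ((\<lambda>s. u' (\<gamma> s)) ` {0..t})" "compact ((\<lambda>s. v' (\<gamma> s)) ` {0..t})"
    by (intro compact_continuous_image compact_Icc continuous_on_compose2[OF u'(2) \<gamma>c]
        continuous_on_compose2[OF v'(2) \<gamma>c] image_subsetI \<gamma>I; assumption)+
  then obtain Ku Kv where Ku: "\<And>s. s \<in> {0..t} \<Longrightarrow> norm (u' (\<gamma> s)) \<le> Ku"
    and Kv: "\<And>s. s \<in> {0..t} \<Longrightarrow> norm (v' (\<gamma> s)) \<le> Kv"
    by (metis bounded_iff compact_imp_bounded imageI)
  define a where "a s = u (\<gamma> s) - U (s, z)" for s
  define b where "b s = v (\<gamma> s) - V (s, z)" for s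
  \<comment> \<open>The velocity of the curve is \<open>(U, V)\<close> rather than \<open>(u, v)\<close>, so every term of the derivative
    of \<open>(a, b)\<close> is linear in \<open>(a, b)\<close> itself.\<close>
  define D' where "D' s = (l * b s - blinfun_apply (u' (\<gamma> s)) (0, a s, b s),
    - (l * a s) - blinfun_apply (v' (\<gamma> s)) (0, a s, b s))" for s
  have "(a t, b t) = 0"
  \<comment> \<open>The constant adds the bounds of the two components of \<open>D'\<close>:
    \<open>l\<close> from the rotation term and \<open>Ku\<close> or \<open>Kv\<close> from the
    gradient term.\<close>
  proof (rule gronwall_zero[where D = "\<lambda>s. (a s, b s)" and D' = D' and K = "(l + Ku) + (l + Kv)"])
    fix s assume s: "s \<in> {0..t}"
    then have sI: "s \<in> ?I" using t by auto
    have diff: "(0 :: real, a s, b s) = (1, u (\<gamma> s), v (\<gamma> s)) - (1, U (s, z), V (s, z))"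
      by (simp add: a_def b_def)
    have "D' s = (blinfun_apply (u' (\<gamma> s)) (1, U (s, z), V (s, z)) - l * V (s, z),
        blinfun_apply (v' (\<gamma> s)) (1, U (s, z), V (s, z)) - - l * U (s, z))"
      using pde[OF \<gamma>I[OF s]] unfolding D'_def diff blinfun.diff_right
      by (simp add: a_def b_def algebra_simps)
    moreover have "((\<lambda>s. u (\<gamma> s)) has_vector_derivative
        blinfun_apply (u' (\<gamma> s)) (1, U (s, z), V (s, z))) (at s within ?I)"
      "((\<lambda>s. v (\<gamma> s)) has_vector_derivative
        blinfun_apply (v' (\<gamma> s)) (1, U (s, z), V (s, z))) (at s within ?I)"
      unfolding \<gamma>_def by (rule along_characteristic[OF u'(1) sI] along_characteristic[OF v'(1) sI]; assumption)+
    moreover have "((\<lambda>s. U (s, z)) has_vector_derivative l * V (s, z)) (at s within ?I)"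
      "((\<lambda>s. V (s, z)) has_vector_derivative - l * U (s, z)) (at s within ?I)"
      by (rule U_deriv V_deriv)+
    ultimately have "((\<lambda>s. (a s, b s)) has_vector_derivative D' s) (at s within ?I)"
      by (simp only: a_def b_def) (intro has_vector_derivative_Pair has_vector_derivative_diff)
    then show "((\<lambda>s. (a s, b s)) has_vector_derivative D' s) (at s within {0..t})"
      using t by (auto intro: has_vector_derivative_within_subset)
    have n: "norm (0 :: real, a s, b s) = norm (a s, b s)" by (simp add: norm_Pair)
    have ab: "\<bar>a s\<bar> \<le> norm (a s, b s)" "\<bar>b s\<bar> \<le> norm (a s, b s)"
      using norm_fst_le[of "a s" "b s"] norm_snd_le[of "b s" "a s"] by auto
    have "\<bar>blinfun_apply (u' (\<gamma> s)) (0, a s, b s)\<bar> \<le> Ku * norm (a s, b s)"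
      "\<bar>blinfun_apply (v' (\<gamma> s)) (0, a s, b s)\<bar> \<le> Kv * norm (a s, b s)"
      using norm_blinfun[of "u' (\<gamma> s)" "(0, a s, b s)"] norm_blinfun[of "v' (\<gamma> s)" "(0, a s, b s)"]
        mult_right_mono[OF Ku[OF s], of "norm (a s, b s)"]
        mult_right_mono[OF Kv[OF s], of "norm (a s, b s)"] by (auto simp: n)
    moreover have "\<bar>l * a s\<bar> \<le> l * norm (a s, b s)" "\<bar>l * b s\<bar> \<le> l * norm (a s, b s)"
      using ab l by (auto simp: abs_mult)
    ultimately have "norm (fst (D' s)) \<le> (l + Ku) * norm (a s, b s)"
      "norm (snd (D' s)) \<le> (l + Kv) * norm (a s, b s)"
      unfolding D'_def by (auto simp: distrib_right)
    then show "norm (D' s) \<le> ((l + Ku) + (l + Kv)) * norm (a s, b s)"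
      using norm_Pair_le[of "fst (D' s)" "snd (D' s)"] by (simp add: distrib_right)
  next
    have "\<gamma> 0 = (0, z)" by (simp add: \<gamma>_def shift_def zero_prod_def[symmetric])
    then show "(a 0, b 0) = 0"
      using sol by (cases z) (simp add: a_def b_def U_def V_def classical_solution_def zero_prod_def)
    show "0 \<le> t" using t by simp
  qed
  then show ?thesis by (simp add: a_def b_def \<gamma>_def zero_prod_def)
qed

lemma global_classical_solution:
  "\<exists>u v. classical_solution l u0 v0 {0..} u v \<and>
     (\<forall>T>0. \<forall>u' v'. classical_solution l u0 v0 {0..<T} u' v' \<longrightarrow>
        (\<forall>t\<in>{0..<T}. \<forall>x y. u' (t, x, y) = u (t, x, y) \<and> v' (t, x, y) = v (t, x, y)))"
proof -
  obtain Z where Z: "C1_on (\<lambda>p. (fst p, Z p)) UNIV" "\<And>t z. Z (t, z + shift (t, z)) = z"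
    "\<And>t z. Z (t, z) + shift (t, Z (t, z)) = z" by (rule shift_inverse) blast
  \<comment> \<open>\<open>Z (t, w)\<close> is the initial position of the particle that is at
    \<open>w\<close> at time \<open>t\<close>, so this passes from Lagrangian to Eulerian
    coordinates.\<close>
  define u where "u p = U (fst p, Z p)" for p
  define v where "v p = V (fst p, Z p)" for p
  have "classical_solution l u0 v0 {0..} u v"
  proof (rule classical_solutionI)
    show "C1_on u UNIV" "C1_on v UNIV"
      unfolding u_def v_def
      by (rule C1_on_compose[OF C1_on_U Z(1)] C1_on_compose[OF C1_on_V Z(1)]; simp)+
    show "\<exists>z. w = z + shift (t, z)" for t w using Z(3) by metis
  qed (simp_all add: u_def v_def Z(2))
  moreover have "u' (t, w) = u (t, w) \<and> v' (t, w) = v (t, w)"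
    if "classical_solution l u0 v0 {0..<T} u' v'" "t \<in> {0..<T}" for T u' v' t w
    \<comment> \<open>The characteristic starting at \<open>Z (t, w)\<close> passes through
      \<open>w\<close> at time \<open>t\<close>.\<close>
    using classical_solution_along_characteristic[OF that, of "Z (t, w)"]
    by (simp add: Z(3) u_def v_def)
  ultimately show ?thesis by (intro exI[of _ u] exI[of _ v]) blast
qed

end

text \<open>The second conjunct justifies speaking of the solution: every classical solution on a
  finite interval agrees there with the global one. The threshold form covers all sufficiently large
  \<open>l\<close>, not just one value.\<close>

theorem corollary1:
  fixes u0 v0 :: "real \<times> real \<Rightarrow> real"
  assumes "C1_on u0 UNIV" and "C1_on v0 UNIV"
    and "bounded (range (partial_x u0))" and "bounded (range (partial_y u0))"
    and "bounded (range (partial_x v0))" and "bounded (range (partial_y v0))"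
  shows "\<exists>l0>0. \<forall>l\<ge>l0. \<exists>u v.
           classical_solution l u0 v0 {0..} u v \<and>
           (\<forall>T>0. \<forall>u' v'. classical_solution l u0 v0 {0..<T} u' v' \<longrightarrow>
              (\<forall>t\<in>{0..<T}. \<forall>x y. u' (t, x, y) = u (t, x, y) \<and> v' (t, x, y) = v (t, x, y)))"
proof -
  have "bounded (range (partial_x u0) \<union> range (partial_y u0) \<union> range (partial_x v0) \<union> range (partial_y v0))"
    using assms(3-6) by simp
  then obtain B where B: "\<bar>partial_x u0 z\<bar> \<le> B" "\<bar>partial_y u0 z\<bar> \<le> B"
    "\<bar>partial_x v0 z\<bar> \<le> B" "\<bar>partial_y v0 z\<bar> \<le> B" for z
    unfolding bounded_iff by force
  have "B \<ge> 0" using B(1)[of 0] by linarith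
  obtain u0' where u0': "\<And>z. (u0 has_derivative blinfun_apply (u0' z)) (at z)" "continuous_on UNIV u0'"
    by (rule C1_onE[OF assms(1)]) blast
  obtain v0' where v0': "\<And>z. (v0 has_derivative blinfun_apply (v0' z)) (at z)" "continuous_on UNIV v0'"
    by (rule C1_onE[OF assms(2)]) blast
  \<comment> \<open>Partials bounded by \<open>B\<close> give \<open>M = 2 * B\<close>, so
    \<open>6 * M = 12 * B\<close>; the extra 1 makes the inequality strict and keeps
    \<open>l\<close> positive when \<open>B = 0\<close>.\<close>
  have "inertial_flow l (2 * B) u0 v0 u0' v0'" if "l \<ge> 12 * B + 1" for l
  proof
    show "0 < l" "6 * (2 * B) < l" using that \<open>B \<ge> 0\<close> by auto
  qed (fact u0' v0' derivative_bound_of_partials[OF u0'(1) B(1,2)]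
      derivative_bound_of_partials[OF v0'(1) B(3,4)])+
  then show ?thesis
    using \<open>B \<ge> 0\<close>
    by (intro exI[of _ "12 * B + 1"] conjI allI impI inertial_flow.global_classical_solution) auto
qed

end
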